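(* Let $K$ be a compact set in $\mathbb{R}^d$. If there is a closed half-sphere $D \subset \partial B(K)$ such that $K \cap D$ has measure $0$ under the Haar measure of $\partial B(K)$, then the family $\mathcal{W}_{\mathrm{iso}}(K)$ does not admit an exact Helly theorem for the volume.
   Context: For a compact set $K\subset\mathbb{R}^d$, $B(K)$ denotes the minimum volume ball such that $K\subset B(K)$, and $\partial B(K)$ is its boundary. The Haar measure of $\partial B(K)$ is the rotation-invariant probability measure on this sphere. If $c$ is the center of $B(K)$, a closed half-sphere of $\partial B(K)$ is a set of the form $\{x\in\partial B(K): \langle x-c,u\rangle\ge 0\}$ with $u$ a unit vector. $O(d)$ is the group of orthogonal $d\times d$ matrices, and for a matrix $A$, $AK=\{Ax: x\in K\}$. The family of scaled isometric copies of $K$ is $$\mathcal{W}_{\mathrm{iso}}(K)=\{a+\alpha AK : A\in O(d),\ \alpha\in\mathbb{R},\ a\in\mathbb{R}^d\}.$$ For a family $\mathcal{W}$ of sets in $\mathbb{R}^d$, the Helly number $h(\mathcal{W})$ is the smallest positive integer $n$, if it exists, such that for every finite family $\mathcal{F}$ of convex sets in $\mathbb{R}^d$: if the intersection of every $n$ or fewer sets of $\mathcal{F}$ contains a set of $\mathcal{W}$, then $\bigcap\mathcal{F}$ contains a set of $\mathcal{W}$. If no such $n$ exists, $h(\mathcal{W})=\infty$. The family $\mathcal{W}$ admits an exact Helly theorem for the volume if $h(\mathcal{W}')<\infty$, where $\mathcal{W}'=\{W\in\mathcal{W}: \operatorname{vol}(W)\ge 1\}$.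
   Formalization: K is assumed to have positive volume. If vol(K) = 0, no copy has volume at least 1, so the Helly number is 1 and the claim fails, for example when K is the three vertices of an equilateral triangle in the plane. *)

theory Defs
  imports "HOL-Probability.Probability" "HOL-Library.Extended_Nat"
begin

definition min_volume_ball :: "(real ^ 'n) set \<Rightarrow> real ^ 'n \<Rightarrow> real \<Rightarrow> bool" where
  "min_volume_ball K c r \<longleftrightarrow> 0 \<le> r \<and> K \<subseteq> cball c r \<and>
     (\<forall>c' r'. K \<subseteq> cball c' r' \<longrightarrow>
        emeasure lebesgue (cball c r) \<le> emeasure lebesgue (cball c' r'))"

(* Invariance is required under all of O(d), reflections included. For d \<ge> 2 this is the same as
   invariance under SO(d), but for d = 1 proper rotations would not determine the measure. *)
definition haar_sphere_measure ::
    "real ^ 'n \<Rightarrow> real \<Rightarrow> (real ^ 'n) measure \<Rightarrow> bool" where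
  "haar_sphere_measure c r \<mu> \<longleftrightarrow>
     sets \<mu> = sets (restrict_space borel (sphere c r)) \<and> prob_space \<mu> \<and>
     (\<forall>A. orthogonal_matrix A \<longrightarrow> distr \<mu> \<mu> (\<lambda>x. c + A *v (x - c)) = \<mu>)"

definition closed_half_sphere :: "real ^ 'n \<Rightarrow> real \<Rightarrow> (real ^ 'n) set \<Rightarrow> bool" where
  "closed_half_sphere c r D \<longleftrightarrow>
     (\<exists>u. norm u = 1 \<and> D = {x \<in> sphere c r. (x - c) \<bullet> u \<ge> 0})"

definition scaled_isometric_copies :: "(real ^ 'n) set \<Rightarrow> (real ^ 'n) set set" where
  "scaled_isometric_copies K =
     {(\<lambda>x. a + \<alpha> *\<^sub>R (A *v x)) ` K | a \<alpha> A. orthogonal_matrix A}"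

(* The empty subfamily, with intersection UNIV, counts among the subfamilies of at most n sets;
   this only matters when W is empty. *)
definition helly_property :: "(real ^ 'n) set set \<Rightarrow> nat \<Rightarrow> bool" where
  "helly_property W n \<longleftrightarrow>
     (\<forall>F. finite F \<and> (\<forall>C\<in>F. convex C) \<and>
        (\<forall>G. G \<subseteq> F \<and> card G \<le> n \<longrightarrow> (\<exists>S\<in>W. S \<subseteq> \<Inter>G)) \<longrightarrow>
        (\<exists>S\<in>W. S \<subseteq> \<Inter>F))"

definition helly_number :: "(real ^ 'n) set set \<Rightarrow> enat" where
  "helly_number W =
     (if \<exists>n>0. helly_property W n then enat (LEAST n. n > 0 \<and> helly_property W n) else \<infinity>)"

definition exact_helly_for_volume :: "(real ^ 'n) set set \<Rightarrow> bool" where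
  "exact_helly_for_volume W \<longleftrightarrow> helly_number {S \<in> W. emeasure lebesgue S \<ge> 1} < \<infinity>"

end

theory Submission
  imports Defs
begin

text \<open>Let \<open>c\<close>, \<open>r\<close> be the centre and radius of the minimum ball, and let \<open>\<beta>\<close> be the factor that scales
  \<open>K\<close> to volume \<open>1\<close>. A copy of volume at least \<open>1\<close> has scale at least \<open>\<beta>\<close>, hence its minimum ball has
  radius at least \<open>\<beta> r\<close>, and it fits in no ball of smaller radius. So consider half-spaces
  \<open>{x. x \<bullet> v \<le> \<beta> \<rho>}\<close> with \<open>\<rho> < r\<close>: for \<open>v\<close> in a fine enough finite net of the unit sphere their
  intersection lies in a ball of radius less than \<open>\<beta> r\<close>, so it contains no such copy. It remains to
  find \<open>\<rho> < r\<close>, depending only on \<open>K\<close> and \<open>n\<close>, such that any \<open>n\<close> of these half-spaces do contain a copy of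
  scale \<open>\<beta>\<close>; then no finite \<open>n\<close> is a Helly number.

  Fix unit vectors \<open>v\<^sub>1, ..., v\<^sub>n\<close> and normalise \<open>c = 0\<close>. A rotated copy \<open>g\<^sup>-\<^sup>1 K\<close> is contained in
  \<open>{x. x \<bullet> v\<^sub>i \<le> r}\<close>, and it touches the boundary exactly when the point \<open>r g v\<^sub>i\<close> of the sphere
  belongs to \<open>K\<close>. Let \<open>u\<close> be the pole of the half-sphere \<open>D\<close> for which \<open>K \<inter> D\<close> is null. If a rotation
  \<open>g\<close> avoids \<open>K \<inter> D\<close>, that is, \<open>r g v\<^sub>i \<notin> K \<inter> D\<close> for all \<open>i\<close>, then the touching indices satisfy
  \<open>g v\<^sub>i \<bullet> u < 0\<close>, and a small translation in the direction \<open>g\<^sup>-\<^sup>1 u\<close> moves the copy off all the bounding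
  hyperplanes at once (\<open>copy_strictly_inside_supporting_halfspaces\<close>).

  Such a rotation exists for topological reasons. A nonempty open part of the sphere has positive
  Haar measure, because finitely many of its rotated images cover the sphere; so the closed null set
  \<open>K \<inter> D\<close> has dense complement (\<open>haar_null_closed_nowhere_dense\<close>). For each \<open>i\<close> the rotations \<open>g\<close> with
  \<open>r g v\<^sub>i \<notin> K \<inter> D\<close> then form a dense open set, and finitely many dense open sets have a common element
  (\<open>exists_orthogonal_avoiding\<close>). In this way only the Haar measure of the sphere is involved, not that
  of the orthogonal group.

  Finally, \<open>\<rho>\<close> can be chosen uniformly in \<open>v\<^sub>1, ..., v\<^sub>n\<close> since a strict inclusion persists for nearby
  directions and the set of \<open>n\<close>-tuples of unit vectors is compact (\<open>uniform_support_bound\<close>).\<close>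

section \<open>Rotations avoiding a closed set with dense complement\<close>

definition householder :: "'a::real_inner \<Rightarrow> 'a \<Rightarrow> 'a" where
  "householder w x = x - (2 * (x \<bullet> w) / (w \<bullet> w)) *\<^sub>R w"

lemma orthogonal_transformation_householder: "orthogonal_transformation (householder w)"
proof (cases "w = 0")
  case True
  then show ?thesis by (simp add: householder_def[abs_def])
next
  case False
  have "linear (householder w)"
    by (intro linearI) (auto simp: householder_def algebra_simps inner_add_left add_divide_distrib)
  moreover have "householder w x \<bullet> householder w y = x \<bullet> y" for x y
    using False by (simp add: householder_def inner_diff_left inner_diff_right inner_commute)
  ultimately show ?thesis
    by (simp add: orthogonal_transformation_def)
qed

text \<open>The product of the reflections along \<open>p\<close> and along \<open>p + q\<close> moves \<open>p\<close> to \<open>- p\<close> and then to \<open>q\<close>. Unlike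
  the single reflection that exchanges \<open>p\<close> and \<open>q\<close>, it depends continuously on \<open>q\<close> at \<open>q = p\<close> and
  tends to the identity there.\<close>

definition rotation_taking :: "'a::real_inner \<Rightarrow> 'a \<Rightarrow> 'a \<Rightarrow> 'a" where
  "rotation_taking p q = householder (p + q) \<circ> householder p"

lemma orthogonal_transformation_rotation_taking: "orthogonal_transformation (rotation_taking p q)"
  unfolding rotation_taking_def
  by (intro orthogonal_transformation_compose orthogonal_transformation_householder)

lemma rotation_taking_apply:
  assumes "norm p = 1" "norm q = 1" "q \<noteq> - p"
  shows "rotation_taking p q p = q"
proof -
  have pq: "p \<bullet> p = 1" "q \<bullet> q = 1"
    using assms by (simp_all add: norm_eq_1)
  have "p + q \<noteq> 0"
    using assms(3) by (metis add.commute eq_neg_iff_add_eq_0)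
  then have "(p + q) \<bullet> (p + q) \<noteq> 0" by simp
  then have "2 * (- p \<bullet> (p + q)) / ((p + q) \<bullet> (p + q)) = - 1"
    by (simp add: divide_eq_eq) (simp add: inner_add_left inner_add_right pq inner_commute)
  moreover have "householder p p = - p"
    using pq by (simp add: householder_def scaleR_2)
  ultimately show ?thesis
    by (simp only: rotation_taking_def comp_def householder_def[of "p + q"]) simp
qed

lemma tendsto_rotation_taking:
  assumes "p \<noteq> 0"
  shows "((\<lambda>q. rotation_taking p q x) \<longlongrightarrow> x) (at p within S)"
proof -
  have "((\<lambda>q. rotation_taking p q x) \<longlongrightarrow> rotation_taking p p x) (at p within S)"
    unfolding rotation_taking_def householder_def comp_def
    using assms by (intro tendsto_intros) (auto simp: scaleR_2[symmetric])
  moreover have "rotation_taking p p x = x"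
    using assms
    by (simp add: rotation_taking_def householder_def scaleR_2[symmetric] inner_diff_left)
  ultimately show ?thesis by simp
qed

text \<open>The vectors are treated one at a time. If the current \<open>f\<close> sends the new vector to a point \<open>p \<in> N\<close>,
  follow \<open>f\<close> by a rotation taking \<open>p\<close> to a point \<open>q \<notin> N\<close> of the sphere close to \<open>p\<close>. The rotation is close
  to the identity, so the images that were in the open set \<open>- N\<close> remain there.\<close>

lemma exists_orthogonal_avoiding:
  fixes N :: "'a::euclidean_space set"
  assumes "closed N" and dense: "sphere 0 1 \<subseteq> closure (sphere 0 1 - N)"
    and "finite V" "V \<subseteq> sphere 0 1"
  shows "\<exists>f :: 'a \<Rightarrow> 'a. orthogonal_transformation f \<and> (\<forall>v\<in>V. f v \<notin> N)"
  using \<open>finite V\<close> \<open>V \<subseteq> sphere 0 1\<close>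
proof (induction V rule: finite_induct)
  case empty
  then show ?case by (intro exI[of _ "\<lambda>x. x"]) simp
next
  case (insert v V)
  then obtain f where f: "orthogonal_transformation f" "\<forall>w\<in>V. f w \<notin> N" by auto
  define p where "p = f v"
  have p: "norm p = 1"
    using insert.prems f by (simp add: p_def orthogonal_transformation_norm)
  show ?case
  proof (cases "p \<in> N")
    case False
    then show ?thesis using f by (auto simp: p_def)
  next
    case True
    let ?S = "sphere 0 1 - N"
    have "p islimpt ?S"
      using dense p True unfolding closure_def by auto
    then have nontriv: "at p within ?S \<noteq> bot"
      by (simp add: trivial_limit_within)
    have "\<forall>w\<in>V. eventually (\<lambda>q. rotation_taking p q (f w) \<notin> N) (at p within ?S)"
    proof
      fix w assume "w \<in> V"
      then have "f w \<in> - N" using f by auto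
      moreover have "open (- N)" using \<open>closed N\<close> by auto
      moreover have "((\<lambda>q. rotation_taking p q (f w)) \<longlongrightarrow> f w) (at p within ?S)"
        using p by (intro tendsto_rotation_taking) auto
      ultimately show "eventually (\<lambda>q. rotation_taking p q (f w) \<notin> N) (at p within ?S)"
        by (auto dest: topological_tendstoD)
    qed
    then have "eventually (\<lambda>q. \<forall>w\<in>V. rotation_taking p q (f w) \<notin> N) (at p within ?S)"
      using insert.hyps by (intro eventually_ball_finite)
    moreover have "eventually (\<lambda>q. q \<noteq> - p) (at p within ?S)"
    proof (rule tendsto_imp_eventually_ne)
      show "((\<lambda>q. q) \<longlongrightarrow> p) (at p within ?S)" by (rule tendsto_ident_at)
      show "p \<noteq> - p" using p by (simp add: eq_neg_iff_add_eq_0 flip: scaleR_2) auto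
    qed
    moreover have "eventually (\<lambda>q. q \<in> ?S) (at p within ?S)"
      by (simp add: eventually_at_filter)
    ultimately have "eventually (\<lambda>q. (\<forall>w\<in>V. rotation_taking p q (f w) \<notin> N) \<and> q \<noteq> - p \<and> q \<in> ?S)
        (at p within ?S)"
      by (intro eventually_conj)
    then obtain q where q: "\<forall>w\<in>V. rotation_taking p q (f w) \<notin> N" "q \<noteq> - p" "q \<in> ?S"
      using eventually_happens'[OF nontriv] by auto
    then have "rotation_taking p q (f v) \<notin> N"
      using rotation_taking_apply[of p q] p by (auto simp: p_def)
    with q(1) have "\<forall>w\<in>insert v V. (rotation_taking p q \<circ> f) w \<notin> N" by simp
    moreover have "orthogonal_transformation (rotation_taking p q \<circ> f)"
      by (intro orthogonal_transformation_compose orthogonal_transformation_rotation_taking f)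
    ultimately show ?thesis by blast
  qed
qed

section \<open>Null sets of the Haar measure on a sphere\<close>

lemma orthogonal_transformation_bounded_linear:
  fixes f :: "'a::euclidean_space \<Rightarrow> 'b::euclidean_space"
  assumes "orthogonal_transformation f"
  shows "bounded_linear f"
  by (rule linear_conv_bounded_linear[THEN iffD1, OF orthogonal_transformation_linear[OF assms]])

text \<open>Otherwise some open \<open>U\<close> that meets the sphere is null on it. Since the orthogonal group acts
  transitively, the preimages of \<open>U\<close> under orthogonal maps about \<open>c\<close> cover the sphere, and by compactness
  finitely many of them suffice. By invariance each is null, which contradicts total mass \<open>1\<close>.\<close>

lemma haar_null_closed_nowhere_dense:
  fixes c :: "real^'n"
  assumes haar: "haar_sphere_measure c r \<mu>" and "closed N" and null: "emeasure \<mu> (N \<inter> sphere c r) = 0"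
  shows "sphere c r \<subseteq> closure (sphere c r - N)"
proof (rule ccontr)
  let ?S = "sphere c r"
  have sets\<mu>: "sets \<mu> = sets (restrict_space borel ?S)" and "prob_space \<mu>"
    and inv: "\<And>A. orthogonal_matrix A \<Longrightarrow> distr \<mu> \<mu> (\<lambda>x. c + A *v (x - c)) = \<mu>"
    using haar by (auto simp: haar_sphere_measure_def)
  interpret prob_space \<mu> by fact
  have space\<mu>: "space \<mu> = ?S"
    using sets_eq_imp_space_eq[OF sets\<mu>] by (simp add: space_restrict_space)
  have sets_Int: "T \<inter> ?S \<in> sets \<mu>" if "T \<in> sets borel" for T
    using that by (auto simp: sets\<mu> sets_restrict_space)
  assume "\<not> ?S \<subseteq> closure (?S - N)"
  then obtain p where p: "p \<in> ?S" "p \<notin> closure (?S - N)" by blast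
  define U where "U = - closure (?S - N)"
  have "open U" "p \<in> U" using p by (auto simp: U_def)
  have "U \<inter> ?S \<subseteq> N \<inter> ?S" using closure_subset[of "?S - N"] unfolding U_def by blast
  then have "emeasure \<mu> (U \<inter> ?S) \<le> emeasure \<mu> (N \<inter> ?S)"
    using \<open>closed N\<close> by (intro emeasure_mono sets_Int) auto
  with null have nullU: "emeasure \<mu> (U \<inter> ?S) = 0" by simp
  define \<F> where "\<F> = {f :: real^'n \<Rightarrow> real^'n. orthogonal_transformation f}"
  define P where "P f = {x. c + f (x - c) \<in> U}" for f
  have cont: "continuous_on UNIV (\<lambda>x. c + f (x - c))" if "f \<in> \<F>" for f
  proof -
    have "bounded_linear f"
      using that by (auto simp: \<F>_def intro: orthogonal_transformation_bounded_linear)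
    then show ?thesis
      by (intro continuous_intros bounded_linear.continuous_on[of f])
  qed
  have "open (P f)" if "f \<in> \<F>" for f
    using open_vimage[OF \<open>open U\<close> cont[OF that]] by (simp add: P_def vimage_def)
  moreover have "?S \<subseteq> (\<Union>f\<in>\<F>. P f)"
  proof
    fix x assume "x \<in> ?S"
    then have "norm (x - c) = norm (p - c)" using p(1) by (simp add: dist_norm norm_minus_commute)
    then obtain f where "orthogonal_transformation f" "f (x - c) = p - c"
      by (rule orthogonal_transformation_exists)
    then show "x \<in> (\<Union>f\<in>\<F>. P f)" using \<open>p \<in> U\<close> by (auto simp: \<F>_def P_def intro!: bexI[of _ f])
  qed
  moreover have "compact ?S" by simp
  ultimately obtain J where J: "J \<subseteq> \<F>" "finite J" "?S \<subseteq> (\<Union>f\<in>J. P f)"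
    by (elim compactE_image) auto
  have nullP: "emeasure \<mu> (P f \<inter> ?S) = 0" and setsP: "P f \<inter> ?S \<in> sets \<mu>" if "f \<in> \<F>" for f
  proof -
    let ?g = "\<lambda>x. c + f (x - c)"
    have f: "orthogonal_transformation f" using that by (simp add: \<F>_def)
    have gS: "?g x \<in> ?S" if "x \<in> ?S" for x
      using that orthogonal_transformation_norm[OF f] by (simp add: dist_norm norm_minus_commute)
    have "?g \<in> restrict_space borel ?S \<rightarrow>\<^sub>M restrict_space borel ?S"
      using gS borel_measurable_continuous_onI[OF cont[OF that]]
      by (intro measurable_restrict_space3) auto
    then have meas: "?g \<in> \<mu> \<rightarrow>\<^sub>M \<mu>" using measurable_cong_sets[OF sets\<mu> sets\<mu>] by blast
    have "orthogonal_matrix (matrix f)" "\<And>x. matrix f *v x = f x"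
      using f by (simp_all add: orthogonal_transformation_matrix)
    then have "distr \<mu> \<mu> ?g = \<mu>" using inv[of "matrix f"] by simp
    then have "emeasure \<mu> (U \<inter> ?S) = emeasure \<mu> (?g -` (U \<inter> ?S) \<inter> space \<mu>)"
      using emeasure_distr[OF meas] \<open>open U\<close> sets_Int by (metis borel_open)
    also have "?g -` (U \<inter> ?S) \<inter> space \<mu> = P f \<inter> ?S"
      using gS by (auto simp: P_def space\<mu>)
    finally show "emeasure \<mu> (P f \<inter> ?S) = 0" using nullU by simp
    show "P f \<inter> ?S \<in> sets \<mu>"
      using \<open>\<And>f. f \<in> \<F> \<Longrightarrow> open (P f)\<close>[OF that] by (intro sets_Int) auto
  qed
  have "(\<Union>f\<in>J. P f \<inter> ?S) \<in> null_sets \<mu>"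
    using J(1,2) nullP setsP by (intro null_sets.finite_UN) (auto simp: null_sets_def)
  moreover have "(\<Union>f\<in>J. P f \<inter> ?S) = space \<mu>" using J(3) by (auto simp: space\<mu>)
  ultimately show False using emeasure_space_1 by auto
qed

text \<open>The previous lemma for the null part \<open>K \<inter> D\<close> of \<open>K\<close>, transported to the unit sphere by
  \<open>x \<mapsto> (x - c) / r\<close>.\<close>

lemma null_half_sphere_dense:
  fixes K :: "(real^'n) set"
  assumes "haar_sphere_measure c r \<mu>" "closed K" "0 < r"
    and "emeasure \<mu> (K \<inter> {x \<in> sphere c r. 0 \<le> (x - c) \<bullet> u}) = 0"
  shows "sphere 0 1 \<subseteq> closure (sphere 0 1 - {w. c + r *\<^sub>R w \<in> K \<and> 0 \<le> w \<bullet> u})"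
proof
  let ?N = "K \<inter> {x. 0 \<le> (x - c) \<bullet> u}" and ?h = "\<lambda>x. (x - c) /\<^sub>R r"
  have "closed ?N"
    using assms(2) by (intro closed_Int closed_Collect_le continuous_intros)
  moreover have "?N \<inter> sphere c r = K \<inter> {x \<in> sphere c r. 0 \<le> (x - c) \<bullet> u}" by auto
  ultimately have dense: "sphere c r \<subseteq> closure (sphere c r - ?N)"
    using haar_null_closed_nowhere_dense[OF assms(1)] assms(4) by simp
  fix w :: "real^'n" assume "w \<in> sphere 0 1"
  then have "c + r *\<^sub>R w \<in> closure (sphere c r - ?N)"
    using dense assms(3) by (auto simp: dist_norm)
  then have "?h (c + r *\<^sub>R w) \<in> ?h ` closure (sphere c r - ?N)" by (rule imageI)
  also have "\<dots> \<subseteq> closure (?h ` (sphere c r - ?N))"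
    by (intro image_closure_subset continuous_intros closure_subset) auto
  also have "\<dots> \<subseteq> closure (sphere 0 1 - {w. c + r *\<^sub>R w \<in> K \<and> 0 \<le> w \<bullet> u})"
    using assms(3) by (intro closure_mono) (auto simp: dist_norm norm_minus_commute zero_le_mult_iff)
  finally show "w \<in> closure (sphere 0 1 - {w. c + r *\<^sub>R w \<in> K \<and> 0 \<le> w \<bullet> u})"
    using assms(3) by simp
qed

section \<open>Support functions of the copies\<close>

text \<open>On the unit sphere, the set in the density hypothesis is the part of \<open>K\<close> in the half-sphere with pole
  \<open>u\<close>, rescaled from \<open>sphere c r\<close>. With an orthogonal \<open>g\<close> avoiding it on \<open>V\<close> and \<open>f\<close>
  the inverse of \<open>g\<close>, the copy \<open>f (K - c)\<close> can touch the hyperplane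
  \<open>{x. x \<bullet> v = r}\<close> only if \<open>g v\<close> is in the open half-sphere opposite to \<open>u\<close>, and
  translating slightly by a multiple of \<open>f u\<close> separates it from all these hyperplanes.\<close>

lemma copy_strictly_inside_supporting_halfspaces:
  fixes K :: "'a::euclidean_space set"
  assumes K: "compact K" "K \<subseteq> cball c r" and "0 < r" and u: "norm u = 1"
    and dense: "sphere 0 1 \<subseteq> closure (sphere 0 1 - {w. c + r *\<^sub>R w \<in> K \<and> 0 \<le> w \<bullet> u})"
    and V: "finite V" "V \<subseteq> sphere (0::'a) 1"
  shows "\<exists>(f :: 'a \<Rightarrow> 'a) a. orthogonal_transformation f \<and> (\<forall>v\<in>V. \<forall>x\<in>K. (a + f (x - c)) \<bullet> v < r)"
proof -
  let ?N = "{w. c + r *\<^sub>R w \<in> K \<and> 0 \<le> w \<bullet> u}"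
  have "closed ((\<lambda>w. c + r *\<^sub>R w) -` K)"
    using compact_imp_closed[OF K(1)] by (rule continuous_closed_vimage) (intro continuous_intros)
  then have "closed ((\<lambda>w. c + r *\<^sub>R w) -` K \<inter> {w. 0 \<le> w \<bullet> u})"
    by (rule closed_Int) (intro closed_Collect_le continuous_intros)
  also have "(\<lambda>w. c + r *\<^sub>R w) -` K \<inter> {w. 0 \<le> w \<bullet> u} = ?N" by auto
  finally have "closed ?N" .
  then obtain g where g: "orthogonal_transformation g" "\<forall>v\<in>V. g v \<notin> ?N"
    using exists_orthogonal_avoiding[OF _ dense V] by blast
  define f where "f = inv g"
  have f: "orthogonal_transformation f"
    unfolding f_def by (rule orthogonal_transformation_inv[OF g(1)])
  have adj: "f y \<bullet> v = y \<bullet> g v" for y v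
  proof -
    have "g (f y) = y"
      unfolding f_def by (rule surj_f_inv_f[OF orthogonal_transformation_surj[OF g(1)]])
    then show ?thesis using g(1) unfolding orthogonal_transformation_def by metis
  qed
  have bound: "(x - c) \<bullet> w \<le> r" if "x \<in> K" "norm w = 1" for x w
    using norm_cauchy_schwarz[of "x - c" w] K(2) that by (force simp: dist_norm norm_minus_commute)
  \<comment> \<open>Equality in Cauchy-Schwarz: the supporting hyperplane meets the ball only at \<open>c + r *\<^sub>R w\<close>.\<close>
  have strict: "(x - c) \<bullet> w < r" if x: "x \<in> K" and w: "norm w = 1" "c + r *\<^sub>R w \<notin> K" for x w
  proof (rule ccontr)
    assume "\<not> (x - c) \<bullet> w < r"
    then have eq: "(x - c) \<bullet> w = r" using bound[OF x w(1)] by simp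
    have le: "norm (x - c) \<le> r" using K(2) x by (auto simp: dist_norm norm_minus_commute)
    have "(norm (y - r *\<^sub>R w))\<^sup>2 = (norm y)\<^sup>2 - 2 * r * (y \<bullet> w) + r\<^sup>2 * (norm w)\<^sup>2" for y
      unfolding power2_norm_eq_inner
      by (simp add: inner_diff_left inner_diff_right inner_commute power2_eq_square)
    then have "(norm (x - c - r *\<^sub>R w))\<^sup>2 = (norm (x - c))\<^sup>2 - 2 * r * ((x - c) \<bullet> w) + r\<^sup>2 * (norm w)\<^sup>2" .
    also have "\<dots> = (norm (x - c))\<^sup>2 - r\<^sup>2"
      using w(1) by (simp add: eq power2_eq_square)
    also have "\<dots> \<le> 0" using power_mono[OF le, of 2] by simp
    finally have "x = c + r *\<^sub>R w" by (simp add: algebra_simps)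
    then show False using x w(2) by simp
  qed
  \<comment> \<open>The translation is \<open>e *\<^sub>R f u\<close>, and \<open>f u \<bullet> v = u \<bullet> g v\<close>. For directions in the half-sphere of \<open>u\<close> it must
    be smaller than the gap left by the compact set \<open>K\<close>; for all others it moves inwards.\<close>
  have "\<forall>v\<in>V. eventually (\<lambda>e. \<forall>x\<in>K. e * (u \<bullet> g v) + (x - c) \<bullet> g v < r) (at_right 0)"
  proof
    fix v assume v: "v \<in> V"
    define w where "w = g v"
    have w: "norm w = 1" using g(1) V(2) v by (auto simp: w_def orthogonal_transformation_norm)
    show "eventually (\<lambda>e. \<forall>x\<in>K. e * (u \<bullet> g v) + (x - c) \<bullet> g v < r) (at_right 0)"
    proof (cases "0 \<le> w \<bullet> u \<and> K \<noteq> {}")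
      case True
      have "continuous_on K (\<lambda>x. (x - c) \<bullet> w)" by (intro continuous_intros)
      then obtain z where z: "z \<in> K" "\<forall>x\<in>K. (x - c) \<bullet> w \<le> (z - c) \<bullet> w"
        using continuous_attains_sup[OF K(1)] True by blast
      have "c + r *\<^sub>R w \<notin> K" using g(2) v True by (auto simp: w_def)
      then have gap: "0 < r - (z - c) \<bullet> w" using strict[OF z(1) w] by simp
      have "u \<bullet> w \<le> 1" using norm_cauchy_schwarz[of u w] u w by simp
      have "eventually (\<lambda>e. e \<in> {0<..<r - (z - c) \<bullet> w}) (at_right 0)"
        using gap by (rule eventually_at_right_real)
      then show ?thesis
      proof eventually_elim
        case (elim e)
        then have "e * (u \<bullet> w) \<le> e" using \<open>u \<bullet> w \<le> 1\<close> by (simp add: mult_left_le)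
        moreover have "e < r - (z - c) \<bullet> w" using elim by simp
        ultimately show ?case using z(2) unfolding w_def by fastforce
      qed
    next
      case False
      have "eventually (\<lambda>e::real. 0 < e) (at_right 0)" by (simp add: eventually_at_filter)
      then show ?thesis
      proof eventually_elim
        case (elim e)
        show ?case
        proof
          fix x assume x: "x \<in> K"
          then have "e * (u \<bullet> w) < 0" using False elim by (auto simp: inner_commute mult_pos_neg)
          then show "e * (u \<bullet> g v) + (x - c) \<bullet> g v < r" using bound[OF x w] by (simp add: w_def)
        qed
      qed
    qed
  qed
  then have "eventually (\<lambda>e. \<forall>v\<in>V. \<forall>x\<in>K. e * (u \<bullet> g v) + (x - c) \<bullet> g v < r) (at_right 0)"
    using V(1) by (intro eventually_ball_finite)
  then have "\<exists>e. \<forall>v\<in>V. \<forall>x\<in>K. e * (u \<bullet> g v) + (x - c) \<bullet> g v < r"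
    by (rule eventually_happens'[OF trivial_limit_at_right_real])
  then obtain e where "\<forall>v\<in>V. \<forall>x\<in>K. e * (u \<bullet> g v) + (x - c) \<bullet> g v < r" ..
  then have "\<forall>v\<in>V. \<forall>x\<in>K. (e *\<^sub>R f u + f (x - c)) \<bullet> v < r" by (simp add: inner_add_left adj)
  then show ?thesis using f by blast
qed

text \<open>Each tuple of \<open>n\<close> directions has a member of \<open>\<Y>\<close> and a bound \<open>\<rho> < r\<close> that work also for all nearby
  tuples. Finitely many such neighbourhoods cover the compact set of \<open>n\<close>-tuples, and the largest of
  their bounds serves for all.\<close>

lemma uniform_support_bound:
  fixes r :: real and S :: "'a::euclidean_space set"
  assumes "compact S" and "0 < r" and compactY: "\<And>Y. Y \<in> \<Y> \<Longrightarrow> compact Y" and "\<Y> \<noteq> {}"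
    and strict: "\<And>V. finite V \<Longrightarrow> V \<subseteq> S \<Longrightarrow> \<exists>Y\<in>\<Y>. \<forall>v\<in>V. \<forall>y\<in>Y. y \<bullet> v < r"
  obtains \<rho> where "0 \<le> \<rho>" "\<rho> < r"
    "\<And>V. finite V \<Longrightarrow> V \<subseteq> S \<Longrightarrow> card V \<le> n \<Longrightarrow> \<exists>Y\<in>\<Y>. \<forall>v\<in>V. \<forall>y\<in>Y. y \<bullet> v \<le> \<rho>"
proof -
  define W where "W Y \<rho> = {v. \<forall>y\<in>Y. y \<bullet> v < \<rho>}" for Y :: "'a set" and \<rho> :: real
  have open_W: "open (W Y \<rho>)" if Y: "Y \<in> \<Y>" for Y \<rho>
  proof (subst open_contains_ball, intro ballI)
    fix v assume v: "v \<in> W Y \<rho>"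
    obtain M where M: "M > 0" "\<forall>y\<in>Y. norm y \<le> M"
      using compact_imp_bounded[OF compactY[OF Y]] by (auto simp: bounded_pos)
    show "\<exists>e>0. ball v e \<subseteq> W Y \<rho>"
    proof (cases "Y = {}")
      case True
      then show ?thesis by (auto simp: W_def intro: exI[of _ 1])
    next
      case False
      have "continuous_on Y (\<lambda>y. y \<bullet> v)" by (intro continuous_intros)
      then obtain z where z: "z \<in> Y" "\<forall>y\<in>Y. y \<bullet> v \<le> z \<bullet> v"
        using continuous_attains_sup[OF compactY[OF Y] False] by blast
      have gap: "z \<bullet> v < \<rho>" using v z(1) by (simp add: W_def)
      have "y \<bullet> w < \<rho>" if "y \<in> Y" "dist v w < (\<rho> - z \<bullet> v) / M" for y w
      proof -
        have "y \<bullet> (w - v) \<le> norm y * norm (w - v)" by (rule norm_cauchy_schwarz)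
        also have "\<dots> \<le> M * norm (w - v)" using M that(1) by (intro mult_right_mono) auto
        also have "\<dots> < \<rho> - z \<bullet> v"
          using that(2) M(1) by (simp add: dist_norm norm_minus_commute field_simps)
        finally show ?thesis using z(2) that(1) by (auto simp: inner_diff_right)
      qed
      then show ?thesis
        using gap M(1) by (intro exI[of _ "(\<rho> - z \<bullet> v) / M"]) (auto simp: W_def)
    qed
  qed
  \<comment> \<open>On a compact \<open>Y\<close> the supremum is attained, so strict inequalities leave room below \<open>r\<close>.\<close>
  have below: "\<exists>\<rho>. \<rho> < r \<and> V \<subseteq> W Y \<rho>" if Y: "Y \<in> \<Y>" and V: "finite V" "V \<subseteq> W Y r" for Y V
  proof -
    have "\<forall>v\<in>V. eventually (\<lambda>\<rho>. v \<in> W Y \<rho>) (at_left r)"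
    proof
      fix v assume "v \<in> V"
      then have v: "\<forall>y\<in>Y. y \<bullet> v < r" using V(2) by (auto simp: W_def)
      show "eventually (\<lambda>\<rho>. v \<in> W Y \<rho>) (at_left r)"
      proof (cases "Y = {}")
        case False
        have "continuous_on Y (\<lambda>y. y \<bullet> v)" by (intro continuous_intros)
        then obtain z where z: "z \<in> Y" "\<forall>y\<in>Y. y \<bullet> v \<le> z \<bullet> v"
          using continuous_attains_sup[OF compactY[OF Y] False] by blast
        then have "z \<bullet> v < r" using v by auto
        then have "eventually (\<lambda>\<rho>. \<rho> \<in> {z \<bullet> v<..<r}) (at_left r)"
          by (rule eventually_at_left_real)
        then show ?thesis
          by eventually_elim (use z(2) in \<open>force simp: W_def\<close>)
      qed (simp add: W_def)
    qed
    then have "eventually (\<lambda>\<rho>. \<forall>v\<in>V. v \<in> W Y \<rho>) (at_left r)"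
      using V(1) by (intro eventually_ball_finite)
    moreover have "eventually (\<lambda>\<rho>. \<rho> < r) (at_left r)"
      by (simp add: eventually_at_filter)
    ultimately have "eventually (\<lambda>\<rho>. \<rho> < r \<and> V \<subseteq> W Y \<rho>) (at_left r)"
      by eventually_elim auto
    then show ?thesis by (rule eventually_happens'[OF trivial_limit_at_left_real])
  qed
  \<comment> \<open>Tuples are infinite sequences of which only the first \<open>n\<close> entries matter; this lets \<open>n\<close> be a
    number, with Tychonoff's theorem giving compactness.\<close>
  let ?P = "Pi\<^sub>E UNIV (\<lambda>_::nat. S)"
  have "compact ?P"
    using \<open>compact S\<close> compactin_PiE[of "\<lambda>_. euclidean" UNIV "\<lambda>_. S"]
    by (simp add: euclidean_product_topology)
  define I where "I = {(Y, \<rho>). Y \<in> \<Y> \<and> \<rho> < r}"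
  define U where "U = (\<lambda>(Y, \<rho>). {g :: nat \<Rightarrow> 'a. \<forall>i\<in>{..<n}. g i \<in> W Y \<rho>})"
  have cover: "?P \<subseteq> (\<Union>j\<in>I. U j)"
  proof
    fix g assume g: "g \<in> ?P"
    then have "g ` {..<n} \<subseteq> S" by auto
    then obtain Y where "Y \<in> \<Y>" "\<forall>v\<in>g ` {..<n}. \<forall>y\<in>Y. y \<bullet> v < r"
      using strict[of "g ` {..<n}"] by blast
    then have Y: "Y \<in> \<Y>" "g ` {..<n} \<subseteq> W Y r" by (auto simp: W_def)
    then obtain \<rho> where "\<rho> < r" "g ` {..<n} \<subseteq> W Y \<rho>"
      using below[of Y "g ` {..<n}"] by auto
    then show "g \<in> (\<Union>j\<in>I. U j)" using Y(1) by (force simp: I_def U_def)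
  qed
  have "open (U j)" if "j \<in> I" for j
  proof -
    obtain Y \<rho> where j: "j = (Y, \<rho>)" by force
    have "open {g :: nat \<Rightarrow> 'a. \<forall>i\<in>{..<n}. g (id i) \<in> W Y \<rho>}"
      using open_W[of Y \<rho>] that j by (intro product_topology_basis') (auto simp: I_def)
    then show ?thesis by (simp add: j U_def)
  qed
  with \<open>compact ?P\<close> cover obtain J where J: "J \<subseteq> I" "finite J" "?P \<subseteq> (\<Union>j\<in>J. U j)"
    by (elim compactE_image) auto
  \<comment> \<open>\<open>0\<close> is included to make the bound nonnegative.\<close>
  define \<rho> where "\<rho> = Max (insert 0 (snd ` J))"
  show thesis
  proof
    show "0 \<le> \<rho>" using J(2) by (simp add: \<rho>_def)
    show "\<rho> < r" using J(1,2) \<open>0 < r\<close> by (auto simp: \<rho>_def I_def)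
    fix V assume V: "finite V" "V \<subseteq> S" "card V \<le> n"
    show "\<exists>Y\<in>\<Y>. \<forall>v\<in>V. \<forall>y\<in>Y. y \<bullet> v \<le> \<rho>"
    proof (cases "V = {}")
      case True
      then show ?thesis using \<open>\<Y> \<noteq> {}\<close> by auto
    next
      case False
      then obtain v0 where "v0 \<in> V" by auto
      obtain h where h: "bij_betw h {..<card V} V"
        using ex_bij_betw_nat_finite[OF V(1)] by (auto simp: atLeast0LessThan)
      define g where "g i = (if i < card V then h i else v0)" for i
      have gV: "g i \<in> V" for i
        using h \<open>v0 \<in> V\<close> by (auto simp: g_def bij_betw_def)
      then have "g \<in> ?P" using V(2) by auto
      then obtain j where "j \<in> J" "g \<in> U j" using J(3) by blast
      then obtain Y \<sigma> where Y: "(Y, \<sigma>) \<in> J" "\<forall>i<n. g i \<in> W Y \<sigma>"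
        by (cases j) (auto simp: U_def)
      have "\<sigma> \<in> snd ` J" using Y(1) by (force intro: rev_image_eqI)
      then have "\<sigma> \<le> \<rho>" using J(2) by (simp add: \<rho>_def)
      have "v \<in> W Y \<sigma>" if "v \<in> V" for v
      proof -
        have "v \<in> h ` {..<card V}" using that h by (simp add: bij_betw_def)
        then obtain i where "i < card V" "h i = v" by auto
        then show ?thesis using Y(2) V(3) by (auto simp: g_def dest!: spec[of _ i])
      qed
      then have "\<forall>v\<in>V. \<forall>y\<in>Y. y \<bullet> v \<le> \<rho>"
        using \<open>\<sigma> \<le> \<rho>\<close> by (fastforce simp: W_def)
      moreover have "Y \<in> \<Y>" using Y(1) J(1) by (auto simp: I_def)
      ultimately show ?thesis by blast
    qed
  qed
qed

text \<open>If \<open>V\<close> is an \<open>e\<close>-net of the unit sphere, some \<open>v \<in> V\<close> has \<open>x \<bullet> v \<ge> (1 - e) * norm x\<close>, so \<open>x\<close> in the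
  polytope has norm at most \<open>\<rho> / (1 - e)\<close>, which is below \<open>R\<close> for small \<open>e\<close>.\<close>

lemma finite_halfspaces_near_ball:
  assumes "0 \<le> \<rho>" "\<rho> < R"
  obtains V and s :: real where "finite V" "V \<subseteq> sphere (0::'a::euclidean_space) 1" "0 \<le> s" "s < R"
    "\<And>x. (\<forall>v\<in>V. x \<bullet> v \<le> \<rho>) \<Longrightarrow> norm x \<le> s"
proof -
  \<comment> \<open>With this \<open>e\<close>, \<open>\<rho> / (1 - e)\<close> is the bound \<open>2 * R * \<rho> / (R + \<rho>)\<close> used for \<open>s\<close>.\<close>
  define e where "e = (R - \<rho>) / (2 * R)"
  have "0 < R" using assms by simp
  have e: "0 < e" "1 - e = (R + \<rho>) / (2 * R)"
    using assms \<open>0 < R\<close> by (auto simp: e_def field_simps)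
  have "compact (sphere (0::'a) 1)" by simp
  moreover have "sphere (0::'a) 1 \<subseteq> (\<Union>v\<in>sphere 0 1. ball v e)" using e(1) by force
  ultimately obtain V where V: "V \<subseteq> sphere (0::'a) 1" "finite V" "sphere 0 1 \<subseteq> (\<Union>v\<in>V. ball v e)"
    by (elim compactE_image) auto
  show thesis
  proof
    show "0 \<le> 2 * R * \<rho> / (R + \<rho>)" "2 * R * \<rho> / (R + \<rho>) < R"
      using assms \<open>0 < R\<close> by (auto simp: field_simps)
    fix x :: 'a assume x: "\<forall>v\<in>V. x \<bullet> v \<le> \<rho>"
    show "norm x \<le> 2 * R * \<rho> / (R + \<rho>)"
    proof (cases "x = 0")
      case False
      define w where "w = x /\<^sub>R norm x"
      have "w \<in> sphere 0 1" using False by (simp add: w_def)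
      then obtain v where v: "v \<in> V" "dist v w < e" using V(3) by auto
      have "x \<bullet> (w - v) \<le> norm x * norm (w - v)" by (rule norm_cauchy_schwarz)
      also have "\<dots> \<le> norm x * e"
        using v(2) by (intro mult_left_mono) (auto simp: dist_norm norm_minus_commute)
      finally have "x \<bullet> w - norm x * e \<le> x \<bullet> v" by (simp add: inner_diff_right)
      also have "x \<bullet> w = norm x"
        using False by (simp add: w_def dot_square_norm power2_eq_square)
      also have "x \<bullet> v \<le> \<rho>" using x v(1) by auto
      finally have "norm x * (1 - e) \<le> \<rho>" by (simp add: algebra_simps)
      then show ?thesis using assms \<open>0 < R\<close> by (simp add: e(2) field_simps)
    qed (use assms in simp)
  qed (use V in auto)
qed

section \<open>Volume of scaled isometric copies\<close>

text \<open>An open neighbourhood of \<open>K\<close> of almost the same volume is, by Vitali's covering theorem, a countable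
  disjoint union of balls up to a null set. An orthogonal map sends balls to balls of the same radius
  and null sets to null sets.\<close>

lemma emeasure_orthogonal_image_le:
  fixes K :: "'a::euclidean_space set" and f :: "'a \<Rightarrow> 'a"
  assumes "compact K" and f: "orthogonal_transformation f"
  shows "emeasure lebesgue (f ` K) \<le> emeasure lebesgue K"
proof (rule ennreal_le_epsilon)
  fix e :: real assume "0 < e"
  have "K \<in> sets lebesgue" using assms by (simp add: borel_compact)
  then obtain U where U: "open U" "K \<subseteq> U" "U - K \<in> lmeasurable" "emeasure lebesgue (U - K) < ennreal e"
    using sets_lebesgue_outer_open \<open>0 < e\<close> by metis
  define I where "I = {(x, s). 0 < s \<and> ball x s \<subseteq> U}"
  have fine: "\<exists>i\<in>I. x \<in> ball (fst i) (snd i) \<and> snd i < d" if x: "x \<in> U" "0 < d" for x d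
  proof -
    obtain t where "t > 0" "ball x t \<subseteq> U" using U(1) x(1) open_contains_ball by blast
    then have "(x, min t (d/2)) \<in> I" using x by (auto simp: I_def)
    then show ?thesis using \<open>t > 0\<close> x by (intro bexI[of _ "(x, min t (d/2))"]) auto
  qed
  obtain C where C: "countable C" "C \<subseteq> I"
    "pairwise (\<lambda>i j. disjnt (ball (fst i) (snd i)) (ball (fst j) (snd j))) C"
    and neg: "negligible (U - (\<Union>i\<in>C. ball (fst i) (snd i)))"
    by (rule Vitali_covering_theorem_balls[of U I fst snd]) (use fine in blast)+
  let ?N = "U - (\<Union>i\<in>C. ball (fst i) (snd i))"
  have lin: "linear f" using f by (rule orthogonal_transformation_linear)
  have "negligible (f ` ?N)"
    using neg lin by (intro negligible_differentiable_image_negligible linear_imp_differentiable_on) auto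
  then have null: "f ` ?N \<in> null_sets lebesgue" by (simp add: negligible_iff_null_sets)
  have imB: "f ` ball (fst i) (snd i) = ball (f (fst i)) (snd i)" for i
    by (rule image_orthogonal_transformation_ball[OF f])
  have dis: "disjoint_family_on (\<lambda>i. ball (fst i) (snd i)) C"
    using C(3) by (auto simp: disjoint_family_on_def pairwise_def disjnt_def)
  have "disjoint_family_on (\<lambda>i. f ` ball (fst i) (snd i)) C"
    unfolding disjoint_family_on_def
  proof (intro ballI impI)
    fix i j assume "i \<in> C" "j \<in> C" "i \<noteq> j"
    then have "ball (fst i) (snd i) \<inter> ball (fst j) (snd j) = {}"
      using dis unfolding disjoint_family_on_def by blast
    then show "f ` ball (fst i) (snd i) \<inter> f ` ball (fst j) (snd j) = {}"
      using image_Int[OF orthogonal_transformation_inj[OF f]] by (metis image_empty)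
  qed
  then have dis': "disjoint_family_on (\<lambda>i. ball (f (fst i)) (snd i)) C" by (simp add: imB)
  have "emeasure lebesgue (f ` K) \<le> emeasure lebesgue ((\<Union>i\<in>C. ball (f (fst i)) (snd i)) \<union> f ` ?N)"
  proof (rule emeasure_mono)
    have "K \<subseteq> (\<Union>i\<in>C. ball (fst i) (snd i)) \<union> ?N" using U(2) by blast
    then have "f ` K \<subseteq> f ` (\<Union>i\<in>C. ball (fst i) (snd i)) \<union> f ` ?N" by blast
    also have "f ` (\<Union>i\<in>C. ball (fst i) (snd i)) = (\<Union>i\<in>C. ball (f (fst i)) (snd i))"
      by (simp add: image_UN imB)
    finally show "f ` K \<subseteq> (\<Union>i\<in>C. ball (f (fst i)) (snd i)) \<union> f ` ?N" .
    show "(\<Union>i\<in>C. ball (f (fst i)) (snd i)) \<union> f ` ?N \<in> sets lebesgue"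
      using null C(1) by (intro sets.Un sets.countable_UN') auto
  qed
  also have "\<dots> = emeasure lebesgue (\<Union>i\<in>C. ball (f (fst i)) (snd i))"
    using null C(1) by (intro emeasure_Un_null_set sets.countable_UN') auto
  also have "\<dots> = (\<integral>\<^sup>+i. emeasure lebesgue (ball (f (fst i)) (snd i)) \<partial>count_space C)"
    using C(1) dis' by (intro emeasure_UN_countable) auto
  also have "\<dots> = (\<integral>\<^sup>+i. emeasure lebesgue (ball (fst i) (snd i)) \<partial>count_space C)"
    using C(2) by (intro nn_integral_cong) (auto simp: I_def emeasure_ball)
  also have "\<dots> = emeasure lebesgue (\<Union>i\<in>C. ball (fst i) (snd i))"
    using C(1) dis by (intro emeasure_UN_countable[symmetric]) auto
  also have "\<dots> \<le> emeasure lebesgue (K \<union> (U - K))"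
  proof (rule emeasure_mono)
    have "ball (fst i) (snd i) \<subseteq> U" if "i \<in> C" for i
      using C(2) that by (cases i) (auto simp: I_def)
    then show "(\<Union>i\<in>C. ball (fst i) (snd i)) \<subseteq> K \<union> (U - K)" by blast
  qed (use U \<open>K \<in> sets lebesgue\<close> in auto)
  also have "\<dots> \<le> emeasure lebesgue K + emeasure lebesgue (U - K)"
    using \<open>K \<in> sets lebesgue\<close> U by (intro emeasure_subadditive) auto
  also have "\<dots> \<le> emeasure lebesgue K + ennreal e"
    using U(4) by (intro add_left_mono) auto
  finally show "emeasure lebesgue (f ` K) \<le> emeasure lebesgue K + ennreal e" .
qed

lemma emeasure_orthogonal_image:
  fixes K :: "'a::euclidean_space set" and f :: "'a \<Rightarrow> 'a"
  assumes K: "compact K" and f: "orthogonal_transformation f"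
  shows "emeasure lebesgue (f ` K) = emeasure lebesgue K"
proof (rule antisym)
  have "compact (f ` K)"
    using K orthogonal_transformation_linear[OF f]
    by (intro compact_continuous_image linear_continuous_on) (auto simp: linear_conv_bounded_linear)
  then have "emeasure lebesgue (inv f ` f ` K) \<le> emeasure lebesgue (f ` K)"
    using f by (intro emeasure_orthogonal_image_le orthogonal_transformation_inv)
  also have "inv f ` f ` K = K"
    using orthogonal_transformation_inj[OF f] by (simp add: image_image)
  finally show "emeasure lebesgue K \<le> emeasure lebesgue (f ` K)" .
qed (rule emeasure_orthogonal_image_le[OF assms])

lemma emeasure_scaled_isometric_copy:
  fixes K :: "(real^'n) set" and f :: "real^'n \<Rightarrow> real^'n"
  assumes K: "compact K" and f: "orthogonal_transformation f"
  shows "emeasure lebesgue ((\<lambda>x. a + \<alpha> *\<^sub>R f x) ` K) = ennreal (\<bar>\<alpha>\<bar> ^ CARD('n)) * emeasure lebesgue K"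
proof -
  have "(\<lambda>x. a + \<alpha> *\<^sub>R f x) ` K = (\<lambda>x. \<alpha> *\<^sub>R x + a) ` (f ` K)"
    by (simp add: image_image add.commute)
  then show ?thesis
    using emeasure_lebesgue_affine[of \<alpha> a "f ` K"] emeasure_orthogonal_image[OF assms]
    by (simp add: ennreal_power)
qed

lemma scaled_isometric_copies_eq:
  fixes K :: "(real^'n) set"
  shows "scaled_isometric_copies K =
    {(\<lambda>x. a + \<alpha> *\<^sub>R f x) ` K | a \<alpha> f. orthogonal_transformation (f :: real^'n \<Rightarrow> real^'n)}"
proof -
  have to_map: "orthogonal_transformation ((*v) A)" if "orthogonal_matrix A" for A :: "real^'n^'n"
    using that by (simp add: orthogonal_transformation_matrix)
  have to_matrix: "orthogonal_matrix (matrix f) \<and> (*v) (matrix f) = f"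
    if "orthogonal_transformation f" for f :: "real^'n \<Rightarrow> real^'n"
    using that by (simp add: orthogonal_transformation_matrix fun_eq_iff)
  show ?thesis
  proof (intro equalityI subsetI)
    fix S assume "S \<in> scaled_isometric_copies K"
    then obtain a \<alpha> A where "orthogonal_matrix A" "S = (\<lambda>x. a + \<alpha> *\<^sub>R (A *v x)) ` K"
      unfolding scaled_isometric_copies_def by blast
    with to_map show "S \<in> {(\<lambda>x. a + \<alpha> *\<^sub>R f x) ` K | a \<alpha> f. orthogonal_transformation (f :: real^'n \<Rightarrow> real^'n)}" by blast
  next
    fix S assume "S \<in> {(\<lambda>x. a + \<alpha> *\<^sub>R f x) ` K | a \<alpha> f. orthogonal_transformation (f :: real^'n \<Rightarrow> real^'n)}"
    then obtain a \<alpha> f where f: "orthogonal_transformation f" and S: "S = (\<lambda>x. a + \<alpha> *\<^sub>R f x) ` K"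
      by blast
    then have "S = (\<lambda>x. a + \<alpha> *\<^sub>R (matrix f *v x)) ` K" using to_matrix[OF f] by simp
    with to_matrix[OF f] show "S \<in> scaled_isometric_copies K"
      unfolding scaled_isometric_copies_def by blast
  qed
qed

section \<open>Radius of the minimum ball\<close>

lemma min_volume_ball_radius_le:
  fixes K :: "(real^'n) set"
  assumes "min_volume_ball K c r" "K \<subseteq> cball c' s" "0 \<le> s"
  shows "r \<le> s"
proof (rule ccontr)
  assume "\<not> r \<le> s"
  let ?d = "CARD('n)"
  have "emeasure lebesgue (cball c r) \<le> emeasure lebesgue (cball c' s)"
    using assms(1,2) by (auto simp: min_volume_ball_def)
  then have "unit_ball_vol ?d * r ^ ?d \<le> unit_ball_vol ?d * s ^ ?d"
    using \<open>\<not> r \<le> s\<close> assms(3) by (simp add: emeasure_cball ennreal_le_iff)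
  then have "r ^ ?d \<le> s ^ ?d"
    using unit_ball_vol_pos[of ?d] by (simp only: mult_le_cancel_left_pos of_nat_0_le_iff)
  moreover have "s ^ ?d < r ^ ?d"
    using \<open>\<not> r \<le> s\<close> assms(3) zero_less_card_finite by (intro power_strict_mono) simp_all
  ultimately show False by simp
qed

text \<open>Pulling the ball around the copy back by the similarity gives a ball of radius \<open>s / \<bar>\<alpha>\<bar>\<close> around \<open>K\<close>.\<close>

lemma scaled_copy_in_cball_radius:
  fixes K :: "(real^'n) set" and f :: "real^'n \<Rightarrow> real^'n"
  assumes ball: "min_volume_ball K c r" and f: "orthogonal_transformation f" and "\<alpha> \<noteq> 0" "0 \<le> s"
    and sub: "(\<lambda>x. a + \<alpha> *\<^sub>R f x) ` K \<subseteq> cball 0 s"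
  shows "\<bar>\<alpha>\<bar> * r \<le> s"
proof -
  have lin: "linear f" using f by (rule orthogonal_transformation_linear)
  obtain b where b: "f b = a" using orthogonal_transformation_surj[OF f] by (metis surjD)
  have "K \<subseteq> cball (- b /\<^sub>R \<alpha>) (s / \<bar>\<alpha>\<bar>)"
  proof
    fix x assume "x \<in> K"
    then have "norm (a + \<alpha> *\<^sub>R f x) \<le> s" using sub by auto
    moreover have "a + \<alpha> *\<^sub>R f x = f (b + \<alpha> *\<^sub>R x)"
      using b lin by (simp add: linear_add linear_scale)
    ultimately have "norm (b + \<alpha> *\<^sub>R x) \<le> s"
      using orthogonal_transformation_norm[OF f] by simp
    moreover have "b + \<alpha> *\<^sub>R x = \<alpha> *\<^sub>R (x - (- b /\<^sub>R \<alpha>))"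
      using \<open>\<alpha> \<noteq> 0\<close> by (simp add: algebra_simps)
    ultimately have "\<bar>\<alpha>\<bar> * norm (x - (- b /\<^sub>R \<alpha>)) \<le> s" by (metis norm_scaleR)
    then show "x \<in> cball (- b /\<^sub>R \<alpha>) (s / \<bar>\<alpha>\<bar>)"
      using \<open>\<alpha> \<noteq> 0\<close> by (simp only: mem_cball dist_commute[of "- b /\<^sub>R \<alpha>"]) (simp add: dist_norm field_simps)
  qed
  then have "r \<le> s / \<bar>\<alpha>\<bar>"
    using \<open>0 \<le> s\<close> by (intro min_volume_ball_radius_le[OF ball]) auto
  then show ?thesis using \<open>\<alpha> \<noteq> 0\<close> by (simp add: field_simps)
qed

section \<open>Failure of the Helly property\<close>

theorem theorem1p0p1:
  fixes K :: "(real ^ 'n) set" and c :: "real ^ 'n" and r :: real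
    and \<mu> :: "(real ^ 'n) measure"
  assumes "compact K"
    and "emeasure lebesgue K > 0"
    and "min_volume_ball K c r"
    and "haar_sphere_measure c r \<mu>"
    and "\<exists>D. closed_half_sphere c r D \<and> emeasure \<mu> (K \<inter> D) = 0"
  shows "\<not> exact_helly_for_volume (scaled_isometric_copies K)"
proof
  assume "exact_helly_for_volume (scaled_isometric_copies K)"
  then have "helly_number {S \<in> scaled_isometric_copies K. emeasure lebesgue S \<ge> 1} \<noteq> \<infinity>"
    unfolding exact_helly_for_volume_def by (rule less_imp_neq)
  then obtain n where n: "helly_property {S \<in> scaled_isometric_copies K. emeasure lebesgue S \<ge> 1} n"
    unfolding helly_number_def by metis
  let ?d = "CARD('n)"
  have Kball: "K \<subseteq> cball c r" and "0 \<le> r"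
    using assms(3) by (auto simp: min_volume_ball_def)
  \<comment> \<open>Positive volume rules out a degenerate ball.\<close>
  have "r \<noteq> 0"
  proof
    assume "r = 0"
    then have "K \<subseteq> {c}" using Kball by simp
    then have "emeasure lebesgue K \<le> emeasure lebesgue {c}" by (intro emeasure_mono) auto
    then show False using assms(2) by simp
  qed
  with \<open>0 \<le> r\<close> have "0 < r" by simp
  have "emeasure lebesgue K \<noteq> \<infinity>"
    using lmeasurable_compact[OF assms(1)] by (auto simp: fmeasurable_def)
  then obtain vol where vol: "emeasure lebesgue K = ennreal vol" "0 < vol"
    using assms(2) by (cases "emeasure lebesgue K") auto
  define \<beta> where "\<beta> = root ?d (1 / vol)"
  have \<beta>: "0 < \<beta>" "\<beta> ^ ?d * vol = 1"
    using vol(2) by (auto simp: \<beta>_def)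
  have copy_vol: "emeasure lebesgue ((\<lambda>x. a + \<alpha> *\<^sub>R f x) ` K) \<ge> 1 \<longleftrightarrow> \<beta> \<le> \<bar>\<alpha>\<bar>"
    if "orthogonal_transformation f" for f :: "real^'n \<Rightarrow> real^'n" and a \<alpha>
  proof -
    have "emeasure lebesgue ((\<lambda>x. a + \<alpha> *\<^sub>R f x) ` K) = ennreal (\<bar>\<alpha>\<bar> ^ ?d * vol)"
      using emeasure_scaled_isometric_copy[OF assms(1) that] vol by (simp add: ennreal_mult)
    then have "emeasure lebesgue ((\<lambda>x. a + \<alpha> *\<^sub>R f x) ` K) \<ge> 1 \<longleftrightarrow> \<beta> ^ ?d * vol \<le> \<bar>\<alpha>\<bar> ^ ?d * vol"
      using \<beta>(2) by simp
    also have "\<dots> \<longleftrightarrow> \<beta> \<le> \<bar>\<alpha>\<bar>"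
      using vol(2) \<beta>(1) by (simp add: power_mono_iff)
    finally show ?thesis .
  qed
  obtain u where u: "norm u = 1" "emeasure \<mu> (K \<inter> {x \<in> sphere c r. 0 \<le> (x - c) \<bullet> u}) = 0"
    using assms(5) by (auto simp: closed_half_sphere_def)
  have dense: "sphere 0 1 \<subseteq> closure (sphere 0 1 - {w. c + r *\<^sub>R w \<in> K \<and> 0 \<le> w \<bullet> u})"
    using null_half_sphere_dense[OF assms(4) compact_imp_closed[OF assms(1)] \<open>0 < r\<close> u(2)] .
  define \<Y> where "\<Y> = {(\<lambda>x. a + f (x - c)) ` K | a f. orthogonal_transformation (f :: real^'n \<Rightarrow> real^'n)}"
  have \<Y>I: "(\<lambda>x. a + f (x - c)) ` K \<in> \<Y>" if "orthogonal_transformation f" for a and f :: "real^'n \<Rightarrow> real^'n"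
    unfolding \<Y>_def using that by (intro CollectI exI[of _ a] exI[of _ f]) simp
  obtain \<rho> where \<rho>: "0 \<le> \<rho>" "\<rho> < r"
    "\<And>V. finite V \<Longrightarrow> V \<subseteq> sphere (0::real^'n) 1 \<Longrightarrow> card V \<le> n \<Longrightarrow>
      \<exists>Y\<in>\<Y>. \<forall>v\<in>V. \<forall>y\<in>Y. y \<bullet> v \<le> \<rho>"
  proof (rule uniform_support_bound[of "sphere (0::real^'n) 1" r \<Y> n])
    show "compact Y" if Y_in: "Y \<in> \<Y>" for Y
    proof -
      obtain f a where f: "orthogonal_transformation (f :: real^'n \<Rightarrow> real^'n)"
        and Y: "Y = (\<lambda>x. a + f (x - c)) ` K"
        using Y_in by (auto simp: \<Y>_def)
      have "bounded_linear f" by (rule orthogonal_transformation_bounded_linear[OF f])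
      then show ?thesis unfolding Y
        by (intro compact_continuous_image continuous_intros bounded_linear.continuous_on[of f] assms(1))
    qed
    show "\<Y> \<noteq> {}" using \<Y>I[OF orthogonal_transformation_id] by auto
    show "\<exists>Y\<in>\<Y>. \<forall>v\<in>V. \<forall>y\<in>Y. y \<bullet> v < r" if V: "finite V" "V \<subseteq> sphere 0 1" for V
    proof -
      obtain f a where f: "orthogonal_transformation (f :: real^'n \<Rightarrow> real^'n)"
        and "\<forall>v\<in>V. \<forall>x\<in>K. (a + f (x - c)) \<bullet> v < r"
        using copy_strictly_inside_supporting_halfspaces[OF assms(1) Kball \<open>0 < r\<close> u(1) dense V] by blast
      then have "\<forall>v\<in>V. \<forall>y\<in>(\<lambda>x. a + f (x - c)) ` K. y \<bullet> v < r" by simp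
      then show ?thesis using \<Y>I[OF f] by (rule bexI)
    qed
  qed (use \<open>0 < r\<close> in auto)
  have "0 \<le> \<beta> * \<rho>" "\<beta> * \<rho> < \<beta> * r" using \<beta>(1) \<rho>(1,2) by auto
  then obtain V s where V: "finite V" "V \<subseteq> sphere (0::real^'n) 1" and s: "0 \<le> s" "s < \<beta> * r"
    and inside: "\<And>x. (\<forall>v\<in>V. x \<bullet> v \<le> \<beta> * \<rho>) \<Longrightarrow> norm x \<le> s"
    by (rule finite_halfspaces_near_ball) blast
  \<comment> \<open>The family refuting the Helly property for \<open>n\<close>.\<close>
  define H where "H v = {x. x \<bullet> v \<le> \<beta> * \<rho>}" for v :: "real^'n"
  have "\<exists>S\<in>{S \<in> scaled_isometric_copies K. emeasure lebesgue S \<ge> 1}. S \<subseteq> \<Inter>(H ` V)"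
  proof (rule n[unfolded helly_property_def, rule_format], intro conjI ballI allI impI)
    show "finite (H ` V)" using V(1) by simp
    show "convex C" if "C \<in> H ` V" for C
      using that by (auto simp: H_def inner_commute[of _ "_ :: real^'n"] convex_halfspace_le)
    fix G assume G: "G \<subseteq> H ` V \<and> card G \<le> n"
    then obtain V' where V': "V' \<subseteq> V" "inj_on H V'" "G = H ` V'"
      by (auto simp: subset_image_inj)
    then have "card V' \<le> n" using G by (simp add: card_image)
    moreover have "finite V'" "V' \<subseteq> sphere 0 1" using V V'(1) by (auto intro: finite_subset)
    ultimately obtain Y where "Y \<in> \<Y>" and Y: "\<forall>v\<in>V'. \<forall>y\<in>Y. y \<bullet> v \<le> \<rho>"
      using \<rho>(3) by blast
    then obtain f a where f: "orthogonal_transformation (f :: real^'n \<Rightarrow> real^'n)"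
      and Y_eq: "Y = (\<lambda>x. a + f (x - c)) ` K"
      unfolding \<Y>_def by blast
    have fa: "\<forall>v\<in>V'. \<forall>x\<in>K. (a + f (x - c)) \<bullet> v \<le> \<rho>" using Y by (simp add: Y_eq)
    \<comment> \<open>The copy inside the half-spaces of \<open>G\<close>, scaled to volume exactly \<open>1\<close>.\<close>
    define S where "S = (\<lambda>x. \<beta> *\<^sub>R (a - f c) + \<beta> *\<^sub>R f x) ` K"
    have "\<beta> *\<^sub>R (a - f c) + \<beta> *\<^sub>R f x \<in> H v" if "x \<in> K" "v \<in> V'" for x v
    proof -
      have "\<beta> *\<^sub>R (a - f c) + \<beta> *\<^sub>R f x = \<beta> *\<^sub>R (a + f (x - c))"
        using orthogonal_transformation_linear[OF f] by (simp add: linear_diff algebra_simps)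
      then show ?thesis using fa that \<beta>(1) by (simp add: H_def)
    qed
    then have "S \<subseteq> \<Inter>G" by (auto simp: S_def V'(3))
    moreover have "S \<in> scaled_isometric_copies K"
      using f by (auto simp: scaled_isometric_copies_eq S_def)
    moreover have "emeasure lebesgue S \<ge> 1"
      using copy_vol[OF f] \<beta>(1) by (simp add: S_def)
    ultimately show "\<exists>S\<in>{S \<in> scaled_isometric_copies K. emeasure lebesgue S \<ge> 1}. S \<subseteq> \<Inter>G" by blast
  qed
  then obtain f a \<alpha> where f: "orthogonal_transformation f"
    and vol1: "emeasure lebesgue ((\<lambda>x. a + \<alpha> *\<^sub>R f x) ` K) \<ge> 1"
    and sub: "(\<lambda>x. a + \<alpha> *\<^sub>R f x) ` K \<subseteq> \<Inter>(H ` V)"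
    by (auto simp: scaled_isometric_copies_eq)
  have "\<beta> \<le> \<bar>\<alpha>\<bar>" using copy_vol[OF f] vol1 by simp
  moreover have "\<Inter>(H ` V) \<subseteq> cball 0 s" using inside by (auto simp: H_def)
  ultimately have "\<bar>\<alpha>\<bar> * r \<le> s"
    using sub \<beta>(1) s(1) by (intro scaled_copy_in_cball_radius[OF assms(3) f]) auto
  moreover have "\<beta> * r \<le> \<bar>\<alpha>\<bar> * r" using \<open>\<beta> \<le> \<bar>\<alpha>\<bar>\<close> \<open>0 < r\<close> by simp
  ultimately show False using s(2) by simp
qed

end
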